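(* Let $T,S\in \mathcal{B}_A(\mathcal{H})$. Then $$\omega_{A,\mathrm{e}}(T,S)\leq \sqrt{\max\{\|T\|_A^2,\|S\|_A^2\}+\omega_A(S^\sharp T)} .$$ Moreover, this inequality is sharp, in the sense that equality holds for some choice of $\mathcal{H}$, $A$ and $T,S\in\mathcal{B}_A(\mathcal{H})$ with $\|T\|_A\neq 0$.
   Context: $\mathcal{H}$ is a complex Hilbert space with inner product $\langle\cdot\mid\cdot\rangle$, $\mathcal{B}(\mathcal{H})$ is the algebra of bounded linear operators on $\mathcal{H}$, and $A\in\mathcal{B}(\mathcal{H})$ is a nonzero positive (semidefinite) operator. Put $\langle x\mid y\rangle_A=\langle Ax\mid y\rangle$ and $\|x\|_A=\langle x\mid x\rangle_A^{1/2}$. $\mathcal{B}_A(\mathcal{H})=\{T\in\mathcal{B}(\mathcal{H}) : \mathcal{R}(T^*A)\subseteq\mathcal{R}(A)\}$, where $\mathcal{R}$ denotes range; for $T\in\mathcal{B}_A(\mathcal{H})$, $T^\sharp$ denotes the unique $X\in\mathcal{B}(\mathcal{H})$ with $AX=T^*A$ and $\mathcal{R}(X)\subseteq\overline{\mathcal{R}(A)}$ (so $\langle Tx\mid y\rangle_A=\langle x\mid T^\sharp y\rangle_A$). For $T,S\in\mathcal{B}_A(\mathcal{H})$: $\|T\|_A=\sup\{\|Tx\|_A : \|x\|_A=1\}$, $\omega_A(T)=\sup\{|\langle Tx\mid x\rangle_A| : \|x\|_A=1\}$, and $\omega_{A,\mathrm{e}}(T,S)=\sup\{(|\langle Tx\mid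 x\rangle_A|^2+|\langle Sx\mid x\rangle_A|^2)^{1/2} : \|x\|_A=1\}$. All of these are finite. *)

theory Defs
  imports "HOL-Analysis.Analysis"
begin

section \<open>Complex Hilbert spaces\<close>

class complex_vector = real_vector +
  fixes scaleC :: "complex \<Rightarrow> 'a \<Rightarrow> 'a"  (infixr \<open>*\<^sub>C\<close> 75)
  assumes scaleC_add_right: "c *\<^sub>C (x + y) = c *\<^sub>C x + c *\<^sub>C y"
    and scaleC_add_left: "(c + d) *\<^sub>C x = c *\<^sub>C x + d *\<^sub>C x"
    and scaleC_scaleC: "c *\<^sub>C d *\<^sub>C x = (c * d) *\<^sub>C x"
    and scaleC_of_real: "complex_of_real r *\<^sub>C x = r *\<^sub>R x"

text \<open>
  The complex inner product is linear in its first argument. The real inner product of the class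
  \<open>real_inner\<close> is its real part; since \<open>cinner x x\<close> is real by conjugate symmetry, this gives
  \<open>cinner x x = (norm x)\<^sup>2\<close>, so that the positive definiteness of \<open>cinner\<close> and the norm and topology
  it induces are those of \<open>real_inner\<close>.
\<close>

class complex_inner = complex_vector + real_inner +
  fixes cinner :: "'a \<Rightarrow> 'a \<Rightarrow> complex"
  assumes cinner_commute: "cinner x y = cnj (cinner y x)"
    and cinner_add_left: "cinner (x + y) z = cinner x z + cinner y z"
    and cinner_scaleC_left: "cinner (c *\<^sub>C x) y = c * cinner x y"
    and Re_cinner: "Re (cinner x y) = inner x y"
begin

lemma cinner_self: "cinner x x = complex_of_real ((norm x)\<^sup>2)"
proof (rule complex_eqI)
  show "Re (cinner x x) = Re (complex_of_real ((norm x)\<^sup>2))"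
    by (simp add: Re_cinner power2_norm_eq_inner)
  have "Im (cinner x x) = - Im (cinner x x)"
    using arg_cong[OF cinner_commute[of x x], of Im] by simp
  then show "Im (cinner x x) = Im (complex_of_real ((norm x)\<^sup>2))"
    by simp
qed

end

class chilbert_space = complex_inner + complete_space

instance chilbert_space \<subseteq> banach ..

instantiation complex :: chilbert_space
begin

definition scaleC_complex :: "complex \<Rightarrow> complex \<Rightarrow> complex"
  where "scaleC_complex c x = c * x"

definition cinner_complex :: "complex \<Rightarrow> complex \<Rightarrow> complex"
  where "cinner_complex x y = x * cnj y"

instance
  by standard
    (simp_all add: scaleC_complex_def cinner_complex_def inner_complex_def algebra_simps
      scaleR_conv_of_real)

end

section \<open>Bounded operators\<close>

definition bounded_clinear :: "('a::complex_inner \<Rightarrow> 'b::complex_inner) \<Rightarrow> bool"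
  where "bounded_clinear T \<longleftrightarrow> bounded_linear T \<and> (\<forall>c x. T (c *\<^sub>C x) = c *\<^sub>C T x)"

definition cadjoint :: "('a::chilbert_space \<Rightarrow> 'a) \<Rightarrow> 'a \<Rightarrow> 'a"
  where "cadjoint T =
    (THE X. bounded_clinear X \<and> (\<forall>x y. cinner (T x) y = cinner x (X y)))"

definition positive_op :: "('a::chilbert_space \<Rightarrow> 'a) \<Rightarrow> bool"
  where "positive_op A \<longleftrightarrow> bounded_clinear A \<and> (\<forall>x. cinner (A x) x \<in> \<real>\<^sub>\<ge>\<^sub>0)"

section \<open>The semi-inner product induced by a positive operator\<close>

definition A_inner :: "('a::chilbert_space \<Rightarrow> 'a) \<Rightarrow> 'a \<Rightarrow> 'a \<Rightarrow> complex"
  where "A_inner A x y = cinner (A x) y"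

text \<open>For positive \<open>A\<close> the number \<open>A_inner A x x\<close> is real and nonnegative.\<close>

definition A_norm :: "('a::chilbert_space \<Rightarrow> 'a) \<Rightarrow> 'a \<Rightarrow> real"
  where "A_norm A x = sqrt (Re (A_inner A x x))"

definition A_sphere :: "('a::chilbert_space \<Rightarrow> 'a) \<Rightarrow> 'a set"
  where "A_sphere A = {x. A_norm A x = 1}"

definition A_adjointable :: "('a::chilbert_space \<Rightarrow> 'a) \<Rightarrow> ('a \<Rightarrow> 'a) set"
  where "A_adjointable A = {T. bounded_clinear T \<and> range (cadjoint T \<circ> A) \<subseteq> range A}"

definition A_adjoint :: "('a::chilbert_space \<Rightarrow> 'a) \<Rightarrow> ('a \<Rightarrow> 'a) \<Rightarrow> 'a \<Rightarrow> 'a"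
  where "A_adjoint A T =
    (THE X. bounded_clinear X \<and> A \<circ> X = cadjoint T \<circ> A \<and> range X \<subseteq> closure (range A))"

text \<open>
  For nonzero positive \<open>A\<close> and \<open>A\<close>-adjointable operators, each of the following suprema is taken
  over a nonempty set of reals that is bounded above.
\<close>

definition A_opnorm :: "('a::chilbert_space \<Rightarrow> 'a) \<Rightarrow> ('a \<Rightarrow> 'a) \<Rightarrow> real"
  where "A_opnorm A T = (SUP x\<in>A_sphere A. A_norm A (T x))"

definition A_numrad :: "('a::chilbert_space \<Rightarrow> 'a) \<Rightarrow> ('a \<Rightarrow> 'a) \<Rightarrow> real"
  where "A_numrad A T = (SUP x\<in>A_sphere A. cmod (A_inner A (T x) x))"

definition A_euclid_numrad ::
    "('a::chilbert_space \<Rightarrow> 'a) \<Rightarrow> ('a \<Rightarrow> 'a) \<Rightarrow> ('a \<Rightarrow> 'a) \<Rightarrow> real"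
  where "A_euclid_numrad A T S =
    (SUP x\<in>A_sphere A.
      sqrt ((cmod (A_inner A (T x) x))\<^sup>2 + (cmod (A_inner A (S x) x))\<^sup>2))"

end

theory Submission imports Defs begin

text \<open>
  At an \<open>A\<close>-unit vector \<open>x\<close>, the Boas-Bellman inequality for \<open>T x\<close> and \<open>S x\<close> bounds the sum of the
  squared inner products by the larger of the squared seminorms plus the modulus of the inner
  product of \<open>T x\<close> and \<open>S x\<close>, which is that of \<open>S\<^sup>\<sharp> T x\<close> and \<open>x\<close>. For \<open>S\<^sup>\<sharp>\<close> to be given by its
  description it must exist and be bounded; this is a form of Douglas' theorem, proved here with an
  orthogonal projection and Baire's theorem. That the suprema are finite follows from Krein's
  argument for symmetrizable operators. Equality holds if \<open>A\<close>, \<open>T\<close> and \<open>S\<close> are the identity of the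
  complex plane.
\<close>

section \<open>Riesz representation, closures of subspaces and Baire category\<close>

text \<open>The quadratic functional \<open>J\<close> attains its minimum on \<open>M\<close>, and
  its first-order condition is the claim. With \<open>M\<close> the whole space this yields
  adjoints; with \<open>f\<close> an inner product it yields orthogonal projections.\<close>

lemma riesz_closed_subspace:
  fixes f :: "'a::{real_inner,complete_space} \<Rightarrow> real"
  assumes f: "bounded_linear f" and M: "subspace M" "closed M"
  obtains m where "m \<in> M" and "\<And>z. z \<in> M \<Longrightarrow> inner m z = f z"
proof -
  interpret f: bounded_linear f by (fact f)
  define J where "J m = (norm m)\<^sup>2 - 2 * f m" for m
  define d where "d = (INF m\<in>M. J m)"
  obtain K where K: "\<And>x. norm (f x) \<le> norm x * K"
    using f.bounded by blast
  \<comment> \<open>Completing the square: \<open>J m\<close> is at least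
    \<open>(norm m - K)\<^sup>2 - K\<^sup>2\<close>.\<close>
  have "- K\<^sup>2 \<le> J m" for m
  proof -
    have "f m \<le> norm m * K"
      using K[of m] by simp
    moreover have "0 \<le> (norm m - K)\<^sup>2" by simp
    ultimately show ?thesis
      unfolding J_def power2_diff by simp
  qed
  then have bdd: "bdd_below (J ` M)"
    by (auto intro!: bdd_belowI)
  have d_le: "d \<le> J m" if "m \<in> M" for m
    unfolding d_def using bdd that by (rule cINF_lower)
  have "M \<noteq> {}"
    using subspace_0[OF M(1)] by blast
  have "\<exists>m\<in>M. J m < d + 1 / real (Suc n)" for n
    using cINF_less_iff[OF \<open>M \<noteq> {}\<close> bdd, of "d + 1 / real (Suc n)"]
    unfolding d_def by simp
  then obtain s where sM: "\<And>n. s n \<in> M" and s: "\<And>n. J (s n) < d + 1 / real (Suc n)"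
    by metis
  \<comment> \<open>The midpoint of two near-minimisers lies in \<open>M\<close>, so
    \<open>J\<close> is at least \<open>d\<close> there; the parallelogram law then makes them
    close.\<close>
  have close: "(norm (x - y))\<^sup>2 \<le> 4 * e"
    if "x \<in> M" "y \<in> M" "J x < d + e" "J y < d + e" for x y e
  proof -
    have "(1/2) *\<^sub>R (x + y) \<in> M"
      using that M(1) by (simp add: subspace_add subspace_scale)
    moreover have "J ((1/2) *\<^sub>R (x + y)) = (norm (x + y))\<^sup>2 / 4 - f x - f y"
      by (simp add: J_def f.scaleR f.add power_divide del: scaleR_add_right)
        (simp add: add_divide_distrib)
    ultimately have "d \<le> (norm (x + y))\<^sup>2 / 4 - f x - f y"
      using d_le by metis
    moreover have "(norm (x - y))\<^sup>2 = 2 * (norm x)\<^sup>2 + 2 * (norm y)\<^sup>2 - (norm (x + y))\<^sup>2"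
      by (simp add: power2_norm_eq_inner inner_diff inner_add inner_commute)
    ultimately show ?thesis
      using that(3,4) by (simp add: J_def)
  qed
  have "Cauchy s"
  proof (rule metric_CauchyI)
    fix e :: real
    assume "0 < e"
    then obtain N where N: "inverse (real (Suc N)) < e\<^sup>2 / 4"
      using reals_Archimedean[of "e\<^sup>2 / 4"] by auto
    show "\<exists>N. \<forall>m\<ge>N. \<forall>n\<ge>N. dist (s m) (s n) < e"
    proof (intro exI allI impI)
      fix m n
      assume mn: "m \<ge> N" "n \<ge> N"
      have *: "J (s k) < d + 1 / real (Suc N)" if "k \<ge> N" for k
      proof -
        have "1 / real (Suc k) \<le> 1 / real (Suc N)"
          using that by (simp add: frac_le)
        then show ?thesis using s[of k] by linarith
      qed
      have "(norm (s m - s n))\<^sup>2 \<le> 4 * (1 / real (Suc N))"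
        using close[OF sM sM *[OF mn(1)] *[OF mn(2)]] .
      also have "\<dots> < e\<^sup>2"
        using N by (simp add: inverse_eq_divide)
      finally show "dist (s m) (s n) < e"
        using \<open>0 < e\<close> by (simp add: dist_norm power_less_imp_less_base)
    qed
  qed
  then obtain l where l: "s \<longlonglongrightarrow> l"
    using Cauchy_convergent convergent_def by blast
  have lM: "l \<in> M"
    using closed_sequentially[OF M(2)] sM l by blast
  have "(\<lambda>n. J (s n)) \<longlonglongrightarrow> J l"
    unfolding J_def by (intro tendsto_intros l f.tendsto)
  moreover have "(\<lambda>n. d + 1 / real (Suc n)) \<longlonglongrightarrow> d + 0"
    by (intro tendsto_intros LIMSEQ_Suc lim_1_over_n)
  ultimately have "J l \<le> d + 0"
    by (rule LIMSEQ_le) (use s less_imp_le in blast)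
  then have Jl: "J l \<le> J z" if "z \<in> M" for z
    using d_le[OF that] by simp
  have "inner l z = f z" if z: "z \<in> M" for z
  proof (rule ccontr)
    assume ne: "inner l z \<noteq> f z"
    define c where "c = inner l z - f z"
    \<comment> \<open>The added 1 keeps \<open>q\<close> positive when \<open>z = 0\<close>; moving
      from \<open>l\<close> by \<open>t *\<^sub>R z\<close> would still lower
      \<open>J\<close>.\<close>
    define q where "q = (norm z)\<^sup>2 + 1"
    define t where "t = - c / q"
    have q: "q > 0" by (simp add: q_def add_nonneg_pos)
    have "l + t *\<^sub>R z \<in> M"
      using z lM M(1) by (simp add: subspace_add subspace_scale)
    from Jl[OF this] have "0 \<le> t\<^sup>2 * (q - 1) + 2 * t * c"
      unfolding J_def power2_norm_eq_inner c_def q_def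
      by (simp add: inner_add f.add f.scaleR inner_commute algebra_simps power2_eq_square)
    also have "\<dots> = - (c\<^sup>2 * (q + 1) / q\<^sup>2)"
      unfolding t_def using q by (simp add: field_simps power2_eq_square)
    finally have "c\<^sup>2 * (q + 1) / q\<^sup>2 \<le> 0" by simp
    moreover have "c\<^sup>2 * (q + 1) / q\<^sup>2 > 0"
      using q ne by (intro divide_pos_pos mult_pos_pos) (auto simp: c_def)
    ultimately show False by simp
  qed
  with lM show ?thesis by (rule that)
qed

lemma subspace_closure:
  fixes S :: "'a::real_normed_vector set"
  assumes S: "subspace S"
  shows "subspace (closure S)"
  unfolding subspace_def
proof (intro conjI ballI allI)
  show "0 \<in> closure S"
    using subspace_0[OF S] closure_subset by blast
next
  fix x y
  assume "x \<in> closure S" "y \<in> closure S"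
  then obtain f g where "\<And>n. f n \<in> S" "f \<longlonglongrightarrow> x" "\<And>n. g n \<in> S" "g \<longlonglongrightarrow> y"
    unfolding closure_sequential by blast
  then show "x + y \<in> closure S"
    unfolding closure_sequential
    by (intro exI[of _ "\<lambda>n. f n + g n"]) (auto intro: tendsto_add subspace_add[OF S])
next
  fix c :: real and x
  assume "x \<in> closure S"
  then obtain f where "\<And>n. f n \<in> S" "f \<longlonglongrightarrow> x"
    unfolding closure_sequential by blast
  then show "c *\<^sub>R x \<in> closure S"
    unfolding closure_sequential
    by (intro exI[of _ "\<lambda>n. c *\<^sub>R f n"]) (auto intro: tendsto_scaleR subspace_scale[OF S])
qed

text \<open>The sublevel sets cover the space, so by Baire one of them contains a ball; linearity
  moves the bound to a ball around 0.\<close>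

lemma bounded_linear_if_closed_sublevels:
  fixes X :: "'a::banach \<Rightarrow> 'b::real_normed_vector"
  assumes X: "linear X" and cl: "\<And>n::nat. closed {x. norm (X x) \<le> real n}"
  shows "bounded_linear X"
proof -
  interpret X: linear X by (fact X)
  define E where "E n = {x. norm (X x) \<le> real n}" for n
  have "\<exists>n. interior (E n) \<noteq> {}"
  proof (rule ccontr)
    assume "\<not> ?thesis"
    then have "interior (\<Union> (range E)) = {}"
      using Baire_category_alt[of euclidean "range E"] cl completely_metrizable_space_euclidean
      by (auto simp: E_def)
    moreover have "\<Union> (range E) = UNIV"
      using real_arch_simple by (auto simp: E_def)
    ultimately show False by simp
  qed
  then obtain n x0 where "x0 \<in> interior (E n)" by blast
  then obtain r where r: "r > 0" "ball x0 r \<subseteq> E n"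
    by (auto simp: mem_interior)
  \<comment> \<open>\<open>X x\<close> is the difference of the values at \<open>x0 + x\<close> and
    \<open>x0\<close>, both in the ball.\<close>
  have small: "norm (X x) \<le> 2 * real n" if "norm x < r" for x
  proof -
    have "x0 + x \<in> E n" "x0 \<in> E n"
      using that r by (auto simp: dist_norm)
    then have "norm (X x0 + X x) \<le> real n" "norm (X x0) \<le> real n"
      by (auto simp: E_def X.add)
    then show ?thesis
      using norm_triangle_ineq4[of "X x0 + X x" "X x0"] by simp
  qed
  have "norm (X x) \<le> norm x * (4 * real n / r)" for x
  proof (cases "x = 0")
    case False
    define t where "t = r / (2 * norm x)"
    have t: "t > 0" using False r by (simp add: t_def)
    have "norm (t *\<^sub>R x) < r"
      using False r by (simp add: t_def)
    from small[OF this] have "t * norm (X x) \<le> 2 * real n"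
      using t by (simp add: X.scale)
    then show ?thesis
      using False r by (simp add: t_def field_simps)
  qed (simp add: X.zero)
  then show ?thesis
    by (intro bounded_linear_intro[where K = "4 * real n / r"]) (auto simp: X.add X.scale)
qed

section \<open>Complex inner products and Hilbert space adjoints\<close>

lemma cinner_add_right: "cinner x (y + z) = cinner x y + cinner x z"
  by (metis cinner_commute cinner_add_left complex_cnj_add)

lemma cinner_scaleC_right: "cinner x (c *\<^sub>C y) = cnj c * cinner x y"
  by (metis cinner_commute cinner_scaleC_left complex_cnj_mult)

text \<open>Lets identities between real inner products, valid for all vectors, pass to the complex
  ones.\<close>

lemma Im_cinner: "Im (cinner x y) = inner ((- \<i>) *\<^sub>C x) y"
  by (simp add: Re_cinner[symmetric] cinner_scaleC_left)

lemma cinner_eqI: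
  assumes "\<And>z. cinner z x = cinner z y"
  shows "x = y"
proof -
  have "inner z x = inner z y" for z
    using assms[of z] by (metis Re_cinner)
  then show ?thesis
    by (metis inner_commute inner_eq_zero_iff inner_diff_right right_minus_eq)
qed

lemma bounded_clinearI:
  fixes T :: "'a::complex_inner \<Rightarrow> 'b::complex_inner"
  assumes "\<And>x y. T (x + y) = T x + T y" and scale: "\<And>c x. T (c *\<^sub>C x) = c *\<^sub>C T x"
    and "\<And>x. norm (T x) \<le> norm x * K"
  shows "bounded_clinear T"
  unfolding bounded_clinear_def
proof (intro conjI allI scale)
  have "T (r *\<^sub>R x) = r *\<^sub>R T x" for r x
    using scale[of "complex_of_real r" x] by (simp add: scaleC_of_real)
  then show "bounded_linear T"
    using assms by (intro bounded_linear_intro[where K = K]) auto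
qed

lemma bounded_clinear_add: "bounded_clinear T \<Longrightarrow> T (x + y) = T x + T y"
  by (simp add: bounded_clinear_def bounded_linear.linear linear_add)

lemma bounded_clinear_scaleC: "bounded_clinear T \<Longrightarrow> T (c *\<^sub>C x) = c *\<^sub>C T x"
  by (simp add: bounded_clinear_def)

lemma bounded_clinear_compose:
  "bounded_clinear S \<Longrightarrow> bounded_clinear T \<Longrightarrow> bounded_clinear (S \<circ> T)"
  by (auto simp: bounded_clinear_def o_def intro: bounded_linear_compose)

lemma bounded_clinear_id: "bounded_clinear (\<lambda>x. x)"
  by (simp add: bounded_clinear_def)

text \<open>Riesz representation for each fixed \<open>y\<close>. Unique existence is what gives the
  description in \<open>cadjoint\<close> its meaning.\<close>

lemma ex1_cadjoint:
  fixes T :: "'a::chilbert_space \<Rightarrow> 'a"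
  assumes T: "bounded_clinear T"
  shows "\<exists>!X. bounded_clinear X \<and> (\<forall>x y. cinner (T x) y = cinner x (X y))"
proof (rule ex_ex1I)
  have bl: "bounded_linear T"
    using T by (simp add: bounded_clinear_def)
  have "\<exists>p. \<forall>x. inner (T x) y = inner x p" for y
  proof -
    have "bounded_linear (\<lambda>x. inner (T x) y)"
      using bounded_linear_compose[OF bounded_linear_inner_left bl] .
    then show ?thesis
      using riesz_closed_subspace[OF _ subspace_UNIV closed_UNIV]
      by (metis UNIV_I inner_commute)
  qed
  then obtain X where X: "\<And>x y. inner (T x) y = inner x (X y)"
    by metis
  have cX: "cinner (T x) y = cinner x (X y)" for x y
    by (rule complex_eqI)
      (simp_all only: Re_cinner Im_cinner X bounded_clinear_scaleC[OF T, symmetric])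
  obtain K where K: "\<And>x. norm (T x) \<le> norm x * K" "0 \<le> K"
    using bounded_linear.nonneg_bounded[OF bl] by blast
  have "norm (X y) \<le> norm y * K" for y
  proof (cases "X y = 0")
    case False
    \<comment> \<open>Testing the adjoint identity at \<open>X y\<close> itself lets one factor
      \<open>norm (X y)\<close> cancel.\<close>
    have "norm (X y) * norm (X y) = inner (T (X y)) y"
      by (simp add: X power2_norm_eq_inner flip: power2_eq_square)
    also have "\<dots> \<le> norm (T (X y)) * norm y"
      by (rule norm_cauchy_schwarz)
    also have "\<dots> \<le> norm (X y) * K * norm y"
      by (intro mult_right_mono K) simp
    finally show ?thesis
      using False by (simp add: mult.assoc mult.commute)
  qed (use K in simp)
  moreover have "X (x + y) = X x + X y" for x y
    by (rule cinner_eqI) (simp add: cX[symmetric] cinner_add_right)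
  moreover have "X (c *\<^sub>C x) = c *\<^sub>C X x" for c x
    by (rule cinner_eqI) (simp add: cX[symmetric] cinner_scaleC_right)
  ultimately have "bounded_clinear X"
    by (intro bounded_clinearI)
  with cX show "\<exists>X. bounded_clinear X \<and> (\<forall>x y. cinner (T x) y = cinner x (X y))"
    by blast
next
  fix X Y
  assume "bounded_clinear X \<and> (\<forall>x y. cinner (T x) y = cinner x (X y))"
    and "bounded_clinear Y \<and> (\<forall>x y. cinner (T x) y = cinner x (Y y))"
  then show "X = Y"
    by - (rule ext, rule cinner_eqI, metis)
qed

lemma
  assumes "bounded_clinear T"
  shows bounded_clinear_cadjoint: "bounded_clinear (cadjoint T)"
    and cinner_cadjoint: "cinner (T x) y = cinner x (cadjoint T y)"
  using theI'[OF ex1_cadjoint[OF assms], folded cadjoint_def] by blast+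

section \<open>The semi-inner product of a positive operator\<close>

locale positive_operator =
  fixes A :: "'a::chilbert_space \<Rightarrow> 'a"
  assumes positive: "positive_op A"
begin

lemma clinear: "bounded_clinear A"
  using positive by (simp add: positive_op_def)

lemma linear: "linear A"
  using clinear by (simp add: bounded_clinear_def bounded_linear.linear)

lemma A_inner_add_left: "A_inner A (x + y) z = A_inner A x z + A_inner A y z"
  by (simp add: A_inner_def bounded_clinear_add[OF clinear] cinner_add_left)

lemma A_inner_add_right: "A_inner A x (y + z) = A_inner A x y + A_inner A x z"
  by (simp add: A_inner_def cinner_add_right)

lemma A_inner_scaleC_left: "A_inner A (c *\<^sub>C x) y = c * A_inner A x y"
  by (simp add: A_inner_def bounded_clinear_scaleC[OF clinear] cinner_scaleC_left)

lemma A_inner_scaleC_right: "A_inner A x (c *\<^sub>C y) = cnj c * A_inner A x y"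
  by (simp add: A_inner_def cinner_scaleC_right)

lemmas A_inner_sesquilinear =
  A_inner_add_left A_inner_add_right A_inner_scaleC_left A_inner_scaleC_right

lemma Im_A_inner_self: "Im (A_inner A x x) = 0"
  and Re_A_inner_self: "0 \<le> Re (A_inner A x x)"
  using positive by (auto simp: positive_op_def A_inner_def complex_nonneg_Reals_iff)

lemma A_inner_self: "A_inner A x x = complex_of_real ((A_norm A x)\<^sup>2)"
  by (rule complex_eqI) (simp_all add: A_norm_def Im_A_inner_self Re_A_inner_self)

lemma A_norm_nonneg: "0 \<le> A_norm A x"
  by (simp add: A_norm_def Re_A_inner_self)

text \<open>Polarisation: the form is real on the diagonal, hence at \<open>x + y\<close> and
  \<open>x + \<i> *\<^sub>C y\<close>, which forces Hermitian symmetry and so self-adjointness of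
  \<open>A\<close>.\<close>

lemma A_inner_commute: "A_inner A y x = cnj (A_inner A x y)"
proof (rule complex_eqI)
  show "Im (A_inner A y x) = Im (cnj (A_inner A x y))"
    using Im_A_inner_self[of "x + y"] by (simp add: A_inner_sesquilinear Im_A_inner_self)
  show "Re (A_inner A y x) = Re (cnj (A_inner A x y))"
    using Im_A_inner_self[of "x + \<i> *\<^sub>C y"] by (simp add: A_inner_sesquilinear Im_A_inner_self)
qed

lemma self_adjoint: "cinner (A x) y = cinner x (A y)"
  by (metis A_inner_commute A_inner_def cinner_commute)

lemma A_cauchy_schwarz: "cmod (A_inner A x y) \<le> A_norm A x * A_norm A y"
proof -
  define h where "h = A_inner A x y"
  define b where "b = (A_norm A y)\<^sup>2"
  have hyx: "A_inner A y x = cnj h"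
    unfolding h_def by (rule A_inner_commute)
  have nonneg: "0 \<le> (A_norm A x)\<^sup>2 - 2 * t * (cmod h)\<^sup>2 + t\<^sup>2 * (cmod h)\<^sup>2 * b" for t :: real
  proof -
    have "A_inner A (x + (- complex_of_real t * h) *\<^sub>C y) (x + (- complex_of_real t * h) *\<^sub>C y)
        = complex_of_real ((A_norm A x)\<^sup>2 - 2 * t * (cmod h)\<^sup>2 + t\<^sup>2 * (cmod h)\<^sup>2 * b)"
      unfolding A_inner_sesquilinear hyx h_def[symmetric]
      by (simp add: A_inner_self b_def complex_norm_square[of h] del: of_real_power)
        (simp add: power2_eq_square algebra_simps)
    then show ?thesis
      using Re_A_inner_self[of "x + (- complex_of_real t * h) *\<^sub>C y"] by simp
  qed
  \<comment> \<open>The form may be degenerate. If \<open>b = 0\<close>, the expression is affine in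
    \<open>t\<close> and would reach -1 unless \<open>h = 0\<close>; otherwise
    \<open>t = 1 / b\<close> minimises it.\<close>
  have "(cmod h)\<^sup>2 \<le> (A_norm A x)\<^sup>2 * b"
  proof (cases "b = 0")
    case True
    have "h = 0"
    proof (rule ccontr)
      assume "h \<noteq> 0"
      then show False
        using nonneg[of "((A_norm A x)\<^sup>2 + 1) / (2 * (cmod h)\<^sup>2)"] True by simp
    qed
    then show ?thesis using True by simp
  next
    case False
    then have "b > 0" by (simp add: b_def)
    then show ?thesis
      using nonneg[of "1 / b"] by (simp add: field_simps power2_eq_square)
  qed
  then have "(cmod h)\<^sup>2 \<le> (A_norm A x * A_norm A y)\<^sup>2"
    by (simp add: b_def power_mult_distrib)
  then show ?thesis
    unfolding h_def by (rule power2_le_imp_le) (simp add: A_norm_nonneg)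
qed

text \<open>A vector of zero seminorm is killed by \<open>A\<close>, by Cauchy-Schwarz against
  \<open>A x\<close>; hence any \<open>x\<close> with \<open>A x \<noteq> 0\<close> can be
  normalised.\<close>

lemma A_sphere_nonempty:
  assumes "A \<noteq> (\<lambda>x. 0)"
  shows "A_sphere A \<noteq> {}"
proof -
  obtain x where x: "A x \<noteq> 0"
    using assms by auto
  have "A_norm A x \<noteq> 0"
  proof
    assume "A_norm A x = 0"
    then have "A_inner A x (A x) = 0"
      using A_cauchy_schwarz[of x "A x"] by simp
    then show False
      using x by (simp add: A_inner_def cinner_self)
  qed
  then have "A_inner A (complex_of_real (1 / A_norm A x) *\<^sub>C x)
      (complex_of_real (1 / A_norm A x) *\<^sub>C x) = 1"
    unfolding A_inner_sesquilinear by (simp add: A_inner_self power2_eq_square)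
  then have "A_norm A (complex_of_real (1 / A_norm A x) *\<^sub>C x) = 1"
    by (simp add: A_norm_def)
  then show ?thesis
    by (auto simp: A_sphere_def)
qed

section \<open>The closed range of \<open>A\<close> and existence of the
  \<open>A\<close>-adjoint\<close>

text \<open>By self-adjointness the kernel is orthogonal to the range, hence to its closure, so
  \<open>u\<close> is orthogonal to itself.\<close>

lemma eq_zero_if_in_closure_range:
  assumes "u \<in> closure (range A)" and "A u = 0"
  shows "u = 0"
proof -
  have "range A \<subseteq> {z. inner u z = 0}"
    using assms(2) self_adjoint[of u] by (auto simp: Re_cinner[symmetric])
      (metis Re_cinner inner_zero_left)
  moreover have "closed {z. inner u z = 0}"
    by (intro closed_Collect_eq continuous_intros)
  ultimately have "inner u u = 0"
    using assms(1) closure_minimal by blast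
  then show ?thesis by simp
qed

lemma subspace_closure_range: "subspace (closure (range A))"
  by (intro subspace_closure linear_subspace_image linear subspace_UNIV)

text \<open>\<open>subspace\<close> concerns real scalars only; complex ones are handled by
  continuity of scaling.\<close>

lemma closure_range_scaleC:
  assumes "u \<in> closure (range A)"
  shows "c *\<^sub>C u \<in> closure (range A)"
proof -
  have "(\<lambda>u. c *\<^sub>C u) ` closure (range A) \<subseteq> closure (range A)"
  proof (rule image_closure_subset)
    have "norm (c *\<^sub>C u) = norm u * cmod c" for u :: 'a
    proof -
      have "complex_of_real ((norm (c *\<^sub>C u))\<^sup>2) = c * cnj c * cinner u u"
        unfolding cinner_self[symmetric]
        by (simp add: cinner_scaleC_left cinner_scaleC_right)
      also have "\<dots> = complex_of_real ((norm u * cmod c)\<^sup>2)"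
        by (simp only: cinner_self complex_norm_square[symmetric] power_mult_distrib
            of_real_mult of_real_power mult.commute)
      finally have "complex_of_real ((norm (c *\<^sub>C u))\<^sup>2) = complex_of_real ((norm u * cmod c)\<^sup>2)" .
      then have "(norm (c *\<^sub>C u))\<^sup>2 = (norm u * cmod c)\<^sup>2"
        by (simp only: of_real_eq_iff)
      then show ?thesis
        by simp
    qed
    then have "bounded_clinear (\<lambda>u::'a. c *\<^sub>C u)"
      by (intro bounded_clinearI[where K = "cmod c"])
        (auto simp: scaleC_add_right scaleC_scaleC mult.commute)
    then show "continuous_on (closure (range A)) (\<lambda>u. c *\<^sub>C u)"
      by (simp add: bounded_clinear_def linear_continuous_on)
    show "(\<lambda>u. c *\<^sub>C u) ` range A \<subseteq> closure (range A)"
      using closure_subset[of "range A"] by (auto simp flip: bounded_clinear_scaleC[OF clinear])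
  qed simp
  then show ?thesis using assms by blast
qed

text \<open>Take \<open>p\<close> to be the orthogonal projection of \<open>w\<close>: then
  \<open>w - p\<close> is orthogonal to the range, hence in the kernel.\<close>

lemma exists_preimage_in_closure_range: "\<exists>p \<in> closure (range A). A p = A w"
proof -
  obtain p where p: "p \<in> closure (range A)"
    "\<And>z. z \<in> closure (range A) \<Longrightarrow> inner p z = inner w z"
    using riesz_closed_subspace[OF bounded_linear_inner_right subspace_closure_range closed_closure]
    by metis
  have "inner z (A p) = inner z (A w)" for z
  proof -
    have "inner (A z) p = inner (A z) w"
      using p(2)[of "A z"] closure_subset[of "range A"] by (auto simp: inner_commute)
    then show ?thesis
      by (metis Re_cinner self_adjoint)
  qed
  then have "A p = A w"
    by (metis inner_diff_right inner_eq_zero_iff right_minus_eq)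
  with p(1) show ?thesis by blast
qed

lemma inj_on_closure_range:
  assumes "u \<in> closure (range A)" "v \<in> closure (range A)" "A u = A v"
  shows "u = v"
  using eq_zero_if_in_closure_range[of "u - v"] assms
  by (simp add: subspace_diff[OF subspace_closure_range] linear_diff[OF linear])

text \<open>Preimages under \<open>A\<close> in the closed range exist and are unique. Choosing them
  pointwise defines \<open>X\<close>, uniqueness makes it linear, and Baire makes it
  bounded.\<close>

lemma ex1_A_adjoint:
  assumes T: "T \<in> A_adjointable A"
  shows "\<exists>!X. bounded_clinear X \<and> A \<circ> X = cadjoint T \<circ> A \<and> range X \<subseteq> closure (range A)"
proof (rule ex_ex1I)
  let ?N = "closure (range A)"
  have clT: "bounded_clinear T" and ran: "range (cadjoint T \<circ> A) \<subseteq> range A"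
    using T by (auto simp: A_adjointable_def)
  define C where "C = cadjoint T \<circ> A"
  have C: "bounded_clinear C"
    unfolding C_def by (intro bounded_clinear_compose bounded_clinear_cadjoint clT clinear)
  have "\<exists>p \<in> ?N. A p = C x" for x
    using ran exists_preimage_in_closure_range unfolding C_def by (metis rangeE range_subsetD)
  then obtain X where XN: "\<And>x. X x \<in> ?N" and AX: "\<And>x. A (X x) = C x"
    by metis
  have add: "X (x + y) = X x + X y" for x y
    by (rule inj_on_closure_range)
      (simp_all add: XN AX subspace_add[OF subspace_closure_range]
        bounded_clinear_add[OF clinear] bounded_clinear_add[OF C])
  have scale: "X (c *\<^sub>C x) = c *\<^sub>C X x" for c x
    by (rule inj_on_closure_range)
      (simp_all add: XN AX closure_range_scaleC
        bounded_clinear_scaleC[OF clinear] bounded_clinear_scaleC[OF C])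
  have "X (r *\<^sub>R x) = r *\<^sub>R X x" for r x
    using scale[of "complex_of_real r" x] by (simp add: scaleC_of_real)
  then have "linear X"
    by (intro linearI add)
  moreover have "closed {x. norm (X x) \<le> real n}" for n
  proof -
    text \<open>Since \<open>X x\<close> lies in the closed range, its norm is determined by testing against vectors
      \<open>A z\<close>, and \<open>inner (X x) (A z) = inner (C x) z\<close> is continuous in \<open>x\<close>.\<close>
    have "norm (X x) \<le> real n \<longleftrightarrow> (\<forall>z. inner (C x) z \<le> real n * norm (A z))" for x
    proof
      assume "norm (X x) \<le> real n"
      then show "\<forall>z. inner (C x) z \<le> real n * norm (A z)"
        by (metis AX Re_cinner self_adjoint norm_cauchy_schwarz mult_right_mono norm_ge_zero
            order_trans)
    next
      assume bd: "\<forall>z. inner (C x) z \<le> real n * norm (A z)"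
      have "range A \<subseteq> {u. inner (X x) u \<le> real n * norm u}"
        using bd by (auto simp flip: AX) (metis Re_cinner self_adjoint)
      moreover have "closed {u. inner (X x) u \<le> real n * norm u}"
        by (intro closed_Collect_le continuous_intros)
      ultimately have "inner (X x) (X x) \<le> real n * norm (X x)"
        using XN closure_minimal by blast
      then show "norm (X x) \<le> real n"
        by (cases "X x = 0") (simp_all add: power2_norm_eq_inner[symmetric] power2_eq_square)
    qed
    then have "{x. norm (X x) \<le> real n} = (\<Inter>z. {x. inner (C x) z \<le> real n * norm (A z)})"
      by auto
    also have "closed \<dots>"
    proof (intro closed_INT ballI closed_Collect_le continuous_intros)
      show "continuous_on UNIV C"
        using C by (simp add: bounded_clinear_def linear_continuous_on)
    qed
    finally show ?thesis .
  qed
  ultimately have "bounded_linear X"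
    by (rule bounded_linear_if_closed_sublevels)
  then have "bounded_clinear X"
    by (simp add: bounded_clinear_def scale)
  then show "\<exists>X. bounded_clinear X \<and> A \<circ> X = cadjoint T \<circ> A \<and> range X \<subseteq> ?N"
    using XN AX C_def by (intro exI[of _ X]) auto
next
  fix X Y
  assume "bounded_clinear X \<and> A \<circ> X = cadjoint T \<circ> A \<and> range X \<subseteq> closure (range A)"
    and "bounded_clinear Y \<and> A \<circ> Y = cadjoint T \<circ> A \<and> range Y \<subseteq> closure (range A)"
  then show "X = Y"
    by - (rule ext, rule inj_on_closure_range, auto simp: fun_eq_iff)
qed

lemma
  assumes T: "T \<in> A_adjointable A"
  shows bounded_clinear_A_adjoint: "bounded_clinear (A_adjoint A T)"
    and A_inner_A_adjoint: "A_inner A (T x) y = A_inner A x (A_adjoint A T y)"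
proof -
  have X: "bounded_clinear (A_adjoint A T)" "A \<circ> A_adjoint A T = cadjoint T \<circ> A"
    using theI'[OF ex1_A_adjoint[OF T], folded A_adjoint_def] by blast+
  show "bounded_clinear (A_adjoint A T)" by (fact X)
  have "bounded_clinear T"
    using T by (simp add: A_adjointable_def)
  then show "A_inner A (T x) y = A_inner A x (A_adjoint A T y)"
    unfolding A_inner_def self_adjoint using X(2)
    by (simp add: cinner_cadjoint fun_eq_iff)
qed

section \<open>Finiteness of the suprema\<close>

text \<open>Krein's argument: for \<open>B = T\<^sup>\<sharp> T\<close> and an \<open>A\<close>-unit vector \<open>x\<close> let \<open>a n\<close> be the
  \<open>A\<close>-inner product of \<open>B ^^ n\<close> applied to \<open>x\<close> with \<open>x\<close>. Cauchy-Schwarz gives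
  \<open>(a n)\<^sup>2 \<le> a (2 * n)\<close>, so that \<open>a 1\<close> is bounded by the growth rate of the powers of \<open>B\<close> in
  the Hilbert space norm.\<close>

lemma bdd_above_A_norm:
  assumes T: "T \<in> A_adjointable A"
  shows "bdd_above ((\<lambda>x. A_norm A (T x)) ` A_sphere A)"
proof -
  define B where "B = A_adjoint A T \<circ> T"
  have "bounded_clinear B"
    unfolding B_def using T
    by (intro bounded_clinear_compose bounded_clinear_A_adjoint) (auto simp: A_adjointable_def)
  then obtain K where K: "\<And>x. norm (B x) \<le> norm x * K" "0 < K"
    using bounded_linear.pos_bounded[of B] unfolding bounded_clinear_def by blast
  obtain L where L: "\<And>x. norm (A x) \<le> norm x * L" "0 < L"
    using bounded_linear.pos_bounded[of A] clinear unfolding bounded_clinear_def by blast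
  have Bxy: "A_inner A x (B y) = A_inner A (T x) (T y)" for x y
    by (simp add: B_def A_inner_A_adjoint[OF T, symmetric])
  have B: "A_inner A (B x) y = A_inner A x (B y)" for x y
    by (metis A_inner_commute Bxy)
  have Bn: "A_inner A ((B ^^ n) x) y = A_inner A x ((B ^^ n) y)" for n x y
    by (induction n arbitrary: x y) (simp_all add: B funpow_swap1)
  have norm_Bn: "norm ((B ^^ n) x) \<le> norm x * K ^ n" for n x
  proof (induction n)
    case (Suc n)
    have "norm (B ((B ^^ n) x)) \<le> norm ((B ^^ n) x) * K"
      by (rule K)
    also have "\<dots> \<le> norm x * K ^ n * K"
      using Suc K(2) by (intro mult_right_mono) auto
    finally show ?case by (simp add: mult_ac)
  qed simp
  have bound: "(A_norm A (T x))\<^sup>2 \<le> K" if x: "x \<in> A_sphere A" for x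
  proof (rule ccontr)
    assume "\<not> ?thesis"
    then have gt: "1 < (A_norm A (T x))\<^sup>2 / K"
      using K(2) by simp
    define a where "a n = Re (A_inner A x ((B ^^ n) x))" for n
    have a_1: "a 1 = (A_norm A (T x))\<^sup>2"
      by (simp add: a_def Bxy A_inner_self)
    \<comment> \<open>Powers of \<open>B\<close> are symmetric for the semi-inner product, so
      \<open>a (2 * n)\<close> is the squared seminorm of \<open>(B ^^ n) x\<close>.\<close>
    have a_sq: "(a n)\<^sup>2 \<le> a (2 * n)" for n
    proof -
      have "(a n)\<^sup>2 \<le> (cmod (A_inner A x ((B ^^ n) x)))\<^sup>2"
        unfolding a_def by (metis abs_Re_le_cmod abs_ge_zero power2_abs power_mono)
      also have "\<dots> \<le> (A_norm A ((B ^^ n) x))\<^sup>2"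
        using A_cauchy_schwarz[of x "(B ^^ n) x"] x
        by (intro power_mono) (auto simp: A_sphere_def)
      also have "\<dots> = a (2 * n)"
        by (simp add: a_def mult_2 funpow_add Bn[symmetric] A_inner_self)
      finally show ?thesis .
    qed
    have pow: "a 1 ^ (2 ^ n) \<le> a (2 ^ n)" for n
    proof (induction n)
      case (Suc n)
      have "a 1 ^ (2 ^ Suc n) = (a 1 ^ (2 ^ n))\<^sup>2"
        by (simp add: power_mult mult.commute flip: power_mult)
      also have "\<dots> \<le> (a (2 ^ n))\<^sup>2"
        using Suc by (intro power_mono) (simp_all add: a_1[unfolded One_nat_def])
      also have "\<dots> \<le> a (2 ^ Suc n)"
        using a_sq[of "2 ^ n"] by simp
      finally show ?case .
    qed simp
    define c where "c = (norm x)\<^sup>2 * L"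
    \<comment> \<open>Here the Hilbert space norm enters: \<open>c\<close> depends on
      \<open>x\<close> but not on \<open>n\<close>.\<close>
    have le: "a n \<le> c * K ^ n" for n
    proof -
      have "a n \<le> norm (A x) * norm ((B ^^ n) x)"
        unfolding a_def A_inner_def Re_cinner by (rule norm_cauchy_schwarz)
      also have "\<dots> \<le> (norm x * L) * (norm x * K ^ n)"
        using L K(2) norm_Bn by (intro mult_mono) auto
      finally show ?thesis by (simp add: c_def power2_eq_square mult_ac)
    qed
    \<comment> \<open>The ratio exceeds 1, so its powers outgrow \<open>c\<close>, whereas
      \<open>pow\<close> and \<open>le\<close> keep the power with exponent \<open>2 ^ n\<close>
      below \<open>c\<close>.\<close>
    obtain n where n: "c < ((A_norm A (T x))\<^sup>2 / K) ^ n"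
      using real_arch_pow[OF gt] by blast
    also have "\<dots> \<le> ((A_norm A (T x))\<^sup>2 / K) ^ (2 ^ n)"
      using gt less_exp[of n] by (intro power_increasing) auto
    also have "\<dots> \<le> c"
      using order_trans[OF pow le, of n] K(2)
      by (simp add: power_divide divide_le_eq a_1 flip: One_nat_def)
    finally show False by simp
  qed
  show ?thesis
  proof (rule bdd_aboveI2)
    show "A_norm A (T x) \<le> sqrt K" if "x \<in> A_sphere A" for x
      by (rule real_le_rsqrt) (rule bound[OF that])
  qed
qed

lemma A_norm_le_A_opnorm:
  assumes "T \<in> A_adjointable A" and "x \<in> A_sphere A"
  shows "A_norm A (T x) \<le> A_opnorm A T"
  unfolding A_opnorm_def using assms by (intro cSUP_upper bdd_above_A_norm)

text \<open>\<open>A_adjoint A S\<close> moves across the form as \<open>S\<close>. Cauchy-Schwarz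
  and the finite operator seminorms show that the supremum is over a bounded set.\<close>

lemma A_inner_le_A_numrad_adjoint_compose:
  assumes T: "T \<in> A_adjointable A" and S: "S \<in> A_adjointable A" and x: "x \<in> A_sphere A"
  shows "cmod (A_inner A (T x) (S x)) \<le> A_numrad A (A_adjoint A S \<circ> T)"
proof -
  have eq: "cmod (A_inner A ((A_adjoint A S \<circ> T) x) x) = cmod (A_inner A (T x) (S x))" for x
    by (metis A_inner_A_adjoint[OF S] A_inner_commute complex_mod_cnj o_apply)
  have "cmod (A_inner A (T y) (S y)) \<le> A_opnorm A T * A_opnorm A S" if "y \<in> A_sphere A" for y
    using A_cauchy_schwarz[of "T y" "S y"] A_norm_nonneg
      A_norm_le_A_opnorm[OF T that] A_norm_le_A_opnorm[OF S that]
    by (meson mult_mono order_trans)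
  then have "bdd_above ((\<lambda>x. cmod (A_inner A (T x) (S x))) ` A_sphere A)"
    by (rule bdd_aboveI2)
  then show ?thesis
    unfolding A_numrad_def eq using x by (intro cSUP_upper)
qed

section \<open>The Boas-Bellman inequality and the upper bound\<close>

text \<open>Cauchy-Schwarz for \<open>x\<close> and the combination \<open>w\<close> of \<open>u\<close> and \<open>v\<close> whose coefficients are the
  conjugates of the two inner products.\<close>

lemma boas_bellman:
  assumes x: "A_norm A x = 1"
  shows "(cmod (A_inner A u x))\<^sup>2 + (cmod (A_inner A v x))\<^sup>2
    \<le> max ((A_norm A u)\<^sup>2) ((A_norm A v)\<^sup>2) + cmod (A_inner A u v)"
proof -
  define a where "a = A_inner A u x"
  define b where "b = A_inner A v x"
  define p where "p = (cmod a)\<^sup>2 + (cmod b)\<^sup>2"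
  define g where "g = A_inner A u v"
  define M where "M = max ((A_norm A u)\<^sup>2) ((A_norm A v)\<^sup>2)"
  define w where "w = cnj a *\<^sub>C u + cnj b *\<^sub>C v"
  have "A_inner A w x = complex_of_real p"
    unfolding w_def p_def of_real_add complex_norm_square
    by (simp add: A_inner_sesquilinear mult.commute flip: a_def b_def)
  moreover have p: "0 \<le> p"
    by (simp add: p_def)
  ultimately have "p \<le> A_norm A w"
    using A_cauchy_schwarz[of w x] x by simp
  then have "p\<^sup>2 \<le> (A_norm A w)\<^sup>2"
    using p by (rule power_mono)
  also have "\<dots> = Re (A_inner A w w)"
    by (simp add: A_inner_self)
  also have "\<dots> = (cmod a)\<^sup>2 * (A_norm A u)\<^sup>2 + (cmod b)\<^sup>2 * (A_norm A v)\<^sup>2 + 2 * Re (cnj a * b * g)"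
  proof -
    have "A_inner A w w = complex_of_real ((cmod a)\<^sup>2 * (A_norm A u)\<^sup>2 + (cmod b)\<^sup>2 * (A_norm A v)\<^sup>2)
        + (cnj a * b * g + cnj (cnj a * b * g))"
      unfolding w_def of_real_add of_real_mult[of "(cmod _)\<^sup>2"] complex_norm_square[of a]
        complex_norm_square[of b] A_inner_sesquilinear
      by (simp add: A_inner_commute[of v u] A_inner_self algebra_simps
          flip: g_def)
    then show ?thesis by (simp only: complex_add_cnj plus_complex.sel Re_complex_of_real)
  qed
  \<comment> \<open>The diagonal terms are bounded by \<open>M\<close>, the cross term by
    \<open>2 * cmod a * cmod b \<le> p\<close>; a factor \<open>p\<close> can then be
    cancelled.\<close>
  also have "\<dots> \<le> (cmod a)\<^sup>2 * M + (cmod b)\<^sup>2 * M + p * cmod g"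
  proof (intro add_mono mult_left_mono)
    have "2 * Re (cnj a * b * g) \<le> 2 * cmod a * cmod b * cmod g"
      using complex_Re_le_cmod[of "cnj a * b * g"] by (simp add: norm_mult)
    also have "\<dots> \<le> p * cmod g"
      using sum_squares_bound[of "cmod a" "cmod b"] unfolding p_def
      by (intro mult_right_mono) auto
    finally show "2 * Re (cnj a * b * g) \<le> p * cmod g" .
  qed (auto simp: M_def)
  also have "\<dots> = p * (M + cmod g)"
    by (simp add: p_def algebra_simps)
  finally have "p * p \<le> p * (M + cmod g)"
    by (simp add: power2_eq_square)
  moreover have "0 \<le> M + cmod g"
    by (auto simp: M_def le_max_iff_disj intro!: add_nonneg_nonneg)
  ultimately have "p \<le> M + cmod g"
    using p by (cases "p = 0") auto
  then show ?thesis
    by (simp add: p_def M_def a_def b_def g_def)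
qed

lemma A_euclid_numrad_le:
  assumes "A \<noteq> (\<lambda>x. 0)" and T: "T \<in> A_adjointable A" and S: "S \<in> A_adjointable A"
  shows "A_euclid_numrad A T S
    \<le> sqrt (max ((A_opnorm A T)\<^sup>2) ((A_opnorm A S)\<^sup>2) + A_numrad A (A_adjoint A S \<circ> T))"
  unfolding A_euclid_numrad_def
proof (rule cSUP_least)
  show "A_sphere A \<noteq> {}"
    using assms(1) by (rule A_sphere_nonempty)
next
  fix x
  assume x: "x \<in> A_sphere A"
  have "(cmod (A_inner A (T x) x))\<^sup>2 + (cmod (A_inner A (S x) x))\<^sup>2
    \<le> max ((A_norm A (T x))\<^sup>2) ((A_norm A (S x))\<^sup>2) + cmod (A_inner A (T x) (S x))"
    using x by (intro boas_bellman) (simp add: A_sphere_def)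
  also have "\<dots> \<le> max ((A_opnorm A T)\<^sup>2) ((A_opnorm A S)\<^sup>2) + A_numrad A (A_adjoint A S \<circ> T)"
    using x T S A_norm_nonneg
    by (intro add_mono max.mono power_mono A_norm_le_A_opnorm A_inner_le_A_numrad_adjoint_compose)
  finally show "sqrt ((cmod (A_inner A (T x) x))\<^sup>2 + (cmod (A_inner A (S x) x))\<^sup>2)
    \<le> sqrt (max ((A_opnorm A T)\<^sup>2) ((A_opnorm A S)\<^sup>2) + A_numrad A (A_adjoint A S \<circ> T))"
    by simp
qed

end

section \<open>A case of equality\<close>

text \<open>Each supremum is over a function constant on the unit circle, so both sides of the
  inequality become \<open>sqrt (1 + 1)\<close>.\<close>

lemma A_euclid_numrad_id_complex:
  defines "I \<equiv> (\<lambda>x::complex. x)"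
  shows "positive_op I" and "I \<in> A_adjointable I" and "A_opnorm I I = 1"
    and "A_euclid_numrad I I I = sqrt 2" and "A_numrad I (A_adjoint I I \<circ> I) = 1"
proof -
  have inner: "A_inner I x x = complex_of_real ((cmod x)\<^sup>2)" for x
    by (simp add: I_def A_inner_def cinner_self)
  then have norm: "A_norm I x = cmod x" for x
    by (simp add: A_norm_def)
  have sphere: "1 \<in> A_sphere I" "\<And>x. x \<in> A_sphere I \<Longrightarrow> cmod x = 1"
    by (auto simp: A_sphere_def norm)
  have SUP_const: "(SUP x\<in>A_sphere I. f x) = c" if "\<And>x. cmod x = 1 \<Longrightarrow> f x = c" for f and c :: real
  proof -
    have "(SUP x\<in>A_sphere I. f x) = (SUP x\<in>A_sphere I. c)"
      by (intro SUP_cong refl that sphere(2))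
    then show ?thesis
      using sphere(1) by (metis cSUP_const empty_iff)
  qed
  show pos: "positive_op I"
    unfolding positive_op_def
    by (simp add: bounded_clinear_id cinner_self complex_nonneg_Reals_iff I_def)
  then interpret positive_operator I
    by unfold_locales
  show adj: "I \<in> A_adjointable I"
    by (auto simp: A_adjointable_def bounded_clinear_id I_def)
  show "A_opnorm I I = 1"
    unfolding A_opnorm_def by (rule SUP_const) (simp only: norm, simp add: I_def)
  show "A_euclid_numrad I I I = sqrt 2"
    unfolding A_euclid_numrad_def by (rule SUP_const) (simp add: I_def inner[unfolded I_def])
  \<comment> \<open>The form is the ordinary inner product, which separates points, so the adjoint
    identity determines the operator.\<close>
  have "A_adjoint I I = I"
    using A_inner_A_adjoint[OF adj]
    by - (rule ext, rule cinner_eqI, simp add: A_inner_def I_def)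
  then show "A_numrad I (A_adjoint I I \<circ> I) = 1"
    unfolding A_numrad_def by (intro SUP_const) (simp add: I_def inner[unfolded I_def])
qed

theorem theorem2p4:
  fixes A T S :: "'a::chilbert_space \<Rightarrow> 'a"
  assumes "positive_op A" and "A \<noteq> (\<lambda>x. 0)"
    and "T \<in> A_adjointable A" and "S \<in> A_adjointable A"
  shows "A_euclid_numrad A T S
      \<le> sqrt (max ((A_opnorm A T)\<^sup>2) ((A_opnorm A S)\<^sup>2) + A_numrad A (A_adjoint A S \<circ> T))
    \<and> (\<exists>A' T' S' :: complex \<Rightarrow> complex.
        positive_op A' \<and> A' \<noteq> (\<lambda>x. 0) \<and> T' \<in> A_adjointable A' \<and> S' \<in> A_adjointable A' \<and>
        A_opnorm A' T' \<noteq> 0 \<and>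
        A_euclid_numrad A' T' S' =
          sqrt (max ((A_opnorm A' T')\<^sup>2) ((A_opnorm A' S')\<^sup>2)
            + A_numrad A' (A_adjoint A' S' \<circ> T')))"
proof (intro conjI exI)
  interpret positive_operator A
    using assms(1) by unfold_locales
  show "A_euclid_numrad A T S
      \<le> sqrt (max ((A_opnorm A T)\<^sup>2) ((A_opnorm A S)\<^sup>2) + A_numrad A (A_adjoint A S \<circ> T))"
    using assms(2-4) by (rule A_euclid_numrad_le)
next
  let ?I = "\<lambda>x::complex. x"
  show "?I \<noteq> (\<lambda>x. 0)"
    by (metis zero_neq_one)
  show "A_opnorm ?I ?I \<noteq> 0"
    by (simp add: A_euclid_numrad_id_complex)
  show "A_euclid_numrad ?I ?I ?I =
    sqrt (max ((A_opnorm ?I ?I)\<^sup>2) ((A_opnorm ?I ?I)\<^sup>2) + A_numrad ?I (A_adjoint ?I ?I \<circ> ?I))"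
    unfolding A_euclid_numrad_id_complex by simp
qed (fact A_euclid_numrad_id_complex)+

end
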